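(* Let $n \ge 2$ be a fixed integer and $\varepsilon > 0$. Let $x$ and $y$ be natural numbers with $\sqrt{x} < y \le x \mathcal{L}^{-1}$, where $\mathcal{L} = \ln x$. Then for each $k$ with $1 \le k \le n$, $$\int_0^1 |T(\alpha; x, y)|^{2^k} d\alpha \ll y^{2^k - k + \varepsilon},$$ where the implied constant depends on $n$, $k$ and $\varepsilon$.
   Context: $e(t) = e^{2\pi i t}$. For real $\alpha$, $T(\alpha; x, y) = \sum_{x - y < m \le x} e(\alpha m^n)$, the sum over integers $m$. *)

theory Defs
  imports "HOL-Analysis.Analysis"
begin

definition e :: "real \<Rightarrow> complex" where
  "e t = exp (2 * of_real pi * \<i> * of_real t)"

text \<open>The exponent \<open>n\<close>, fixed throughout in the source, is an explicit argument here. The range is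
  taken in the integers, so that \<open>x - y\<close> is not truncated.\<close>

definition T :: "nat \<Rightarrow> real \<Rightarrow> nat \<Rightarrow> nat \<Rightarrow> complex" where
  "T n \<alpha> x y = (\<Sum>m\<in>{int x - int y<..int x}. e (\<alpha> * of_int m ^ n))"

end

theory Submission
  imports Defs "HOL-Computational_Algebra.Primes"
begin

text \<open>Hua's argument, by induction on \<open>k\<close>. Weyl differencing bounds \<open>|T|^(2^k)\<close> by
  \<open>(2y)^(2^k - k - 1)\<close> times a sum of \<open>e(\<alpha> D)\<close>, where \<open>D\<close> runs over the \<open>k\<close>-fold
  differences of \<open>m^n\<close> with shifts below \<open>y\<close> in absolute value. Multiplying by
  \<open>|T|^(2^k)\<close> and integrating, the tuples with a zero shift contribute at most a constant times
  \<open>y^k\<close> times the moment of order \<open>2^k\<close>. For the others \<open>D\<close> is nonzero because \<open>m > 0\<close> and \<open>k < n\<close>;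
  every shift divides \<open>D\<close> and the shifts together with \<open>D\<close> determine \<open>m\<close>, so each value is
  attained \<open>O(y^\<epsilon>)\<close> times by the divisor bound. Here \<open>x < y^2\<close> is what
  keeps \<open>D\<close> polynomially bounded in \<open>y\<close>.\<close>

subsection \<open>The divisor bound\<close>

text \<open>A divisor of a product splits into a divisor of each factor, so multiplication maps
  pairs of divisors onto the divisors of \<open>a * b\<close>.\<close>

lemma card_divisors_mult_le:
  fixes a b :: nat
  assumes "a > 0" "b > 0"
  shows "card {d. d dvd a * b} \<le> card {d. d dvd a} * card {d. d dvd b}"
proof -
  have "{d. d dvd a * b} \<subseteq> (\<lambda>(u, v). u * v) ` ({d. d dvd a} \<times> {d. d dvd b})"
  proof
    fix d assume "d \<in> {d. d dvd a * b}"
    then obtain u v where "d = u * v" "u dvd a" "v dvd b"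
      using division_decomp[of d a b] by auto
    then show "d \<in> (\<lambda>(u, v). u * v) ` ({d. d dvd a} \<times> {d. d dvd b})"
      by auto
  qed
  then have "card {d. d dvd a * b} \<le> card ({d. d dvd a} \<times> {d. d dvd b})"
    using assms by (intro surj_card_le) (auto intro: finite_cartesian_product)
  then show ?thesis by (simp add: card_cartesian_product)
qed

lemma card_divisors_prod_le:
  fixes f :: "'a \<Rightarrow> nat"
  assumes "finite A" "\<And>p. p \<in> A \<Longrightarrow> f p > 0"
  shows "card {d. d dvd prod f A} \<le> (\<Prod>p\<in>A. card {d. d dvd f p})"
  using assms
proof (induction A rule: finite_induct)
  case (insert p A)
  have "card {d. d dvd prod f (insert p A)} \<le> card {d. d dvd f p} * card {d. d dvd prod f A}"
    using insert by (simp add: card_divisors_mult_le prod_pos)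
  also have "\<dots> \<le> card {d. d dvd f p} * (\<Prod>p\<in>A. card {d. d dvd f p})"
    using insert by (intro mult_left_mono) auto
  finally show ?case using insert by simp
qed auto

lemma card_divisors_prime_power_le:
  fixes p :: nat
  assumes "prime p"
  shows "card {d. d dvd p ^ a} \<le> a + 1"
proof -
  have "{d. d dvd p ^ a} \<subseteq> (\<lambda>i. p ^ i) ` {..a}"
    using divides_primepow_nat[OF assms] by auto
  then have "card {d. d dvd p ^ a} \<le> card {..a}"
    by (intro surj_card_le) auto
  then show ?thesis by simp
qed

text \<open>The classical bound d(n) = O(n^\<delta>), obtained one prime power at a time. A large
  prime satisfies a + 1 \<le> p^(a \<delta>) with constant 1; each small prime costs a factor
  \<open>K\<close>, and there are at most \<open>P\<close> of those, whatever \<open>n\<close>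
  is.\<close>

lemma divisor_bound:
  fixes \<delta> :: real
  assumes "\<delta> > 0"
  shows "\<exists>C\<ge>1. \<forall>n::nat. n > 0 \<longrightarrow> real (card {d. d dvd n}) \<le> C * real n powr \<delta>"
proof -
  \<comment> \<open>Chosen so that K (1 + a \<delta> ln 2) \<ge> a + 1, while 1 + a \<delta> ln 2
    \<le> 2^(a \<delta>).\<close>
  define K where "K = 1 + 1 / (\<delta> * ln 2)"
  \<comment> \<open>From \<open>P\<close> on, p^\<delta> \<ge> 2, hence p^(a \<delta>) \<ge> 2^a
    \<ge> a + 1.\<close>
  define P where "P = nat \<lceil>2 powr (1 / \<delta>)\<rceil>"
  define c where "c p = (if p < P then K else 1)" for p :: nat
  have K: "K \<ge> 1" using assms by (simp add: K_def)
  have small: "real a + 1 \<le> K * (real p ^ a) powr \<delta>" if "p \<ge> 2" for p a :: nat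
  proof -
    have *: "1 + real a * (\<delta> * ln 2) \<le> (real p ^ a) powr \<delta>"
    proof -
      have "1 + real a * (\<delta> * ln 2) \<le> exp (real a * (\<delta> * ln 2))"
        by (rule exp_ge_add_one_self)
      also have "\<dots> = (2 ^ a) powr \<delta>" 
        by (simp add: powr_def ln_realpow algebra_simps)
      also have "\<dots> \<le> (real p ^ a) powr \<delta>"
        using that assms by (intro powr_mono2 power_mono) auto
      finally show ?thesis .
    qed
    have "real a + 1 \<le> K * (1 + real a * (\<delta> * ln 2))"
    proof -
      have "K * (1 + real a * (\<delta> * ln 2)) = 1 + real a * (\<delta> * ln 2) + 1 / (\<delta> * ln 2) + real a"
        using assms by (simp add: K_def field_simps)
      then show ?thesis using assms by simp
    qed
    also have "\<dots> \<le> K * (real p ^ a) powr \<delta>"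
      using * K by (intro mult_left_mono) auto
    finally show ?thesis .
  qed
  have large: "real a + 1 \<le> (real p ^ a) powr \<delta>" if "p \<ge> P" "p \<ge> 2" for p a :: nat
  proof -
    have "2 powr (1 / \<delta>) \<le> real p" using that unfolding P_def by linarith
    then have "(2 powr (1 / \<delta>)) powr \<delta> \<le> real p powr \<delta>"
      using assms by (intro powr_mono2) auto
    then have "2 \<le> real p powr \<delta>" using assms by (simp add: powr_powr)
    then have "2 ^ a \<le> (real p powr \<delta>) ^ a" by (intro power_mono) auto
    also have "\<dots> = (real p ^ a) powr \<delta>"
      using that by (simp add: powr_power powr_realpow[symmetric] powr_powr mult.commute)
    finally have "2 ^ a \<le> (real p ^ a) powr \<delta>" .
    moreover have "real a + 1 \<le> 2 ^ a"
      using Bernoulli_inequality[of "1::real" a] by simp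
    ultimately show ?thesis by linarith
  qed
  have "real (card {d. d dvd n}) \<le> K ^ P * real n powr \<delta>" if "n > 0" for n :: nat
  proof -
    define q where "q p = p ^ multiplicity p n" for p :: nat
    have n: "prod q (prime_factors n) = n"
      using that prod_prime_factors[of n] by (simp add: q_def)
    have p2: "p \<ge> 2" "prime p" if "p \<in> prime_factors n" for p
      using that by (auto intro: prime_ge_2_nat)
    have "real (card {d. d dvd n}) \<le> real (\<Prod>p\<in>prime_factors n. card {d. d dvd q p})"
      using card_divisors_prod_le[of "prime_factors n" q] p2(2)
      by (simp only: n of_nat_le_iff) (simp add: q_def prime_gt_0_nat)
    also have "\<dots> = (\<Prod>p\<in>prime_factors n. real (card {d. d dvd q p}))" by simp
    also have "\<dots> \<le> (\<Prod>p\<in>prime_factors n. c p * real (q p) powr \<delta>)"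
    proof (intro prod_mono conjI)
      fix p assume p: "p \<in> prime_factors n"
      have "real (card {d. d dvd q p}) \<le> real (multiplicity p n) + 1"
        using card_divisors_prime_power_le[OF p2(2)[OF p], of "multiplicity p n"] 
        unfolding q_def by linarith
      also have "\<dots> \<le> c p * real (q p) powr \<delta>"
        using small[OF p2(1)[OF p]] large[OF _ p2(1)[OF p]] by (auto simp: c_def q_def)
      finally show "real (card {d. d dvd q p}) \<le> c p * real (q p) powr \<delta>" .
    qed auto
    also have "\<dots> = (\<Prod>p\<in>prime_factors n. c p) * (\<Prod>p\<in>prime_factors n. real (q p) powr \<delta>)"
      by (rule prod.distrib)
    also have "(\<Prod>p\<in>prime_factors n. real (q p) powr \<delta>) = real n powr \<delta>"
      using arg_cong[OF n, of "\<lambda>m. real m powr \<delta>"] by (simp add: prod_powr_distrib)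
    also have "(\<Prod>p\<in>prime_factors n. c p) \<le> K ^ P"
    proof -
      have "(\<Prod>p\<in>prime_factors n. c p) = (\<Prod>p\<in>prime_factors n \<inter> {..<P}. K)"
        unfolding c_def by (subst prod.inter_restrict) (auto intro: prod.cong)
      also have "\<dots> = K ^ card (prime_factors n \<inter> {..<P})" by simp
      also have "\<dots> \<le> K ^ P"
        using card_mono[of "{..<P}" "prime_factors n \<inter> {..<P}"] K
        by (intro power_increasing) auto
      finally show ?thesis .
    qed
    finally show ?thesis by (simp add: mult_right_mono)
  qed
  moreover have "K ^ P \<ge> 1" using K by simp
  ultimately show ?thesis by blast
qed

subsection \<open>Iterated differences\<close>

fun iter_diff :: "int list \<Rightarrow> (int \<Rightarrow> 'a::ab_group_add) \<Rightarrow> int \<Rightarrow> 'a" where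
  "iter_diff [] f m = f m"
| "iter_diff (h # hs) f m = iter_diff hs (\<lambda>m. f (m + h) - f m) m"

text \<open>The points \<open>m\<close> at which \<open>iter_diff hs f\<close> evaluates
  \<open>f\<close> only inside \<open>A\<close>: \<open>m\<close> plus any subset sum of
  \<open>hs\<close> lies in \<open>A\<close>.\<close>

fun diff_domain :: "int list \<Rightarrow> int set \<Rightarrow> int set" where
  "diff_domain [] A = A"
| "diff_domain (h # hs) A = diff_domain hs {m\<in>A. m + h \<in> A}"

lemma diff_domain_subset: "diff_domain hs A \<subseteq> A"
  by (induction hs arbitrary: A) auto

lemma iter_diff_mult:
  fixes f :: "int \<Rightarrow> 'a::comm_ring_1"
  shows "iter_diff hs (\<lambda>m. c * f m) m = c * iter_diff hs f m"
  by (induction hs arbitrary: f) (simp_all flip: right_diff_distrib)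

lemma iter_diff_of_int:
  "iter_diff hs (\<lambda>m. of_int (f m) :: 'a::ring_1) m = of_int (iter_diff hs f m)"
  by (induction hs arbitrary: f) (simp_all flip: of_int_diff)

text \<open>With the head of the list applied first, a shift at the end differences the finished
  function. This is how values at two points are compared in
  \<open>inj_on_iter_diff\<close>.\<close>

lemma iter_diff_snoc: "iter_diff (hs @ [h]) f m = iter_diff hs f (m + h) - iter_diff hs f m"
proof (induction hs arbitrary: f)
  case (Cons a hs)
  then show ?case by simp
qed simp

lemma diff_domain_snoc: "diff_domain (hs @ [h]) A = {m \<in> diff_domain hs A. m + h \<in> diff_domain hs A}"
  by (induction hs arbitrary: A) auto

text \<open>Each differencing at most doubles a bound that holds on the domain.\<close>

lemma abs_iter_diff_le:
  fixes f :: "int \<Rightarrow> int"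
  assumes "\<And>m. m \<in> A \<Longrightarrow> \<bar>f m\<bar> \<le> B" "m \<in> diff_domain hs A"
  shows "\<bar>iter_diff hs f m\<bar> \<le> 2 ^ length hs * B"
  using assms
proof (induction hs arbitrary: f A B)
  case (Cons h hs)
  have "\<bar>iter_diff hs (\<lambda>m. f (m + h) - f m) m\<bar> \<le> 2 ^ length hs * (2 * B)"
  proof (rule Cons.IH)
    fix m assume "m \<in> {m\<in>A. m + h \<in> A}"
    then show "\<bar>f (m + h) - f m\<bar> \<le> 2 * B"
      using Cons.prems(1)[of m] Cons.prems(1)[of "m + h"] by auto
  qed (use Cons.prems in auto)
  then show ?case by simp
qed auto

text \<open>Sums of products of \<open>r\<close> linear factors positive on \<open>A\<close>. Difference quotients
  stay in this class with \<open>r\<close> lowered by one, so an iterated difference is the product of its shifts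
  times a positive integer: this yields divisibility, nonvanishing and injectivity at once.\<close>

inductive pos_form :: "nat \<Rightarrow> int set \<Rightarrow> (int \<Rightarrow> int) \<Rightarrow> bool" where
  one: "pos_form 0 A (\<lambda>_. 1)"
| mult: "pos_form r A g \<Longrightarrow> (\<And>m. m \<in> A \<Longrightarrow> m + c > 0) \<Longrightarrow> pos_form (Suc r) A (\<lambda>m. (m + c) * g m)"
| add: "pos_form r A f \<Longrightarrow> pos_form r A g \<Longrightarrow> pos_form r A (\<lambda>m. f m + g m)"

lemma pos_form_subset: "pos_form r A g \<Longrightarrow> B \<subseteq> A \<Longrightarrow> pos_form r B g"
proof (induction rule: pos_form.induct)
  case (mult r A g c)
  show ?case by (rule pos_form.mult) (use mult in auto)
next
  case (add r A f g)
  show ?case by (rule pos_form.add) (use add in auto)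
qed (rule pos_form.one)

lemma pos_form_pos: "pos_form r A g \<Longrightarrow> m \<in> A \<Longrightarrow> g m > 0"
  by (induction rule: pos_form.induct) (auto intro: add_pos_pos)

text \<open>The rule \<open>mult\<close> never yields degree 0, so only sums of the constant 1
  remain.\<close>

lemma pos_form_const: "pos_form 0 A g \<Longrightarrow> g a = g b"
  by (induction "0::nat" A g rule: pos_form.induct) auto

lemma pos_form_power:
  assumes "\<And>m. m \<in> A \<Longrightarrow> m > 0"
  shows "pos_form n A (\<lambda>m. m ^ n)"
proof (induction n)
  case (Suc n)
  then show ?case using pos_form.mult[OF Suc, of 0] assms by simp
qed (simp add: pos_form.one)

text \<open>The discrete product rule: if g(m + h) - g(m) = h q(m), then (m + c) g(m) has difference
  h ((m + h + c) q(m) + g(m)). The new factor m + h + c is positive because m + h still lies in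
  \<open>A\<close>. The identity is stated for all \<open>m\<close>, so that it can be differenced
  again.\<close>

lemma pos_form_diff:
  assumes "pos_form r A g" "r > 0"
  shows "\<exists>q. pos_form (r - 1) {m\<in>A. m + h \<in> A} q \<and> (\<forall>m. g (m + h) - g m = h * q m)"
  using assms
proof (induction rule: pos_form.induct)
  case (mult r A g c)
  let ?A = "{m\<in>A. m + h \<in> A}"
  have g: "pos_form r ?A g" using mult.hyps(1) by (rule pos_form_subset) auto
  show ?case
  proof (cases "r = 0")
    case True
    \<comment> \<open>The induction hypothesis requires positive degree; in degree 0 the function
      \<open>g\<close> is constant and is itself the quotient.\<close>
    have "g (m + h) = g m" for m
      using mult.hyps(1) True pos_form_const[of A g] by blast
    then have "\<forall>m. (m + h + c) * g (m + h) - (m + c) * g m = h * g m"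
      by (simp add: algebra_simps)
    then show ?thesis using g by auto
  next
    case False
    then obtain q where q: "pos_form (r - 1) ?A q" "\<And>m. g (m + h) - g m = h * q m"
      using mult.IH by auto
    have "pos_form (Suc (r - 1)) ?A (\<lambda>m. (m + (h + c)) * q m)"
    proof (rule pos_form.mult[OF q(1)])
      fix m assume "m \<in> ?A"
      then show "m + (h + c) > 0" using mult.hyps(2)[of "m + h"] by (simp add: add.assoc)
    qed
    then have "pos_form r ?A (\<lambda>m. (m + (h + c)) * q m)" using False by simp
    then have "pos_form r ?A (\<lambda>m. (m + (h + c)) * q m + g m)"
      using g by (rule pos_form.add)
    moreover have "(m + h + c) * g (m + h) - (m + c) * g m = h * ((m + (h + c)) * q m + g m)" for m
    proof -
      have "g (m + h) = g m + h * q m" using q(2)[of m] by simp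
      then show ?thesis by (simp add: algebra_simps)
    qed
    ultimately show ?thesis by auto
  qed
next
  case (add r A f g)
  then obtain p q where p: "pos_form (r - 1) {m\<in>A. m + h \<in> A} p" "\<forall>m. f (m + h) - f m = h * p m"
    and q: "pos_form (r - 1) {m\<in>A. m + h \<in> A} q" "\<forall>m. g (m + h) - g m = h * q m"
    by auto
  have "f (m + h) + g (m + h) - (f m + g m) = h * (p m + q m)" for m
    using p(2)[rule_format, of m] q(2)[rule_format, of m] by (simp add: distrib_left)
  with pos_form.add[OF p(1) q(1)] show ?case by blast
qed auto

text \<open>Each differencing extracts its shift as a constant factor, and constants pass through
  the later differences, so the shifts collect into \<open>prod_list hs\<close>.\<close>

lemma pos_form_iter_diff:
  assumes "pos_form r A g" "length hs \<le> r"
  shows "\<exists>q. pos_form (r - length hs) (diff_domain hs A) q \<and>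
             (\<forall>m. iter_diff hs g m = prod_list hs * q m)"
  using assms
proof (induction hs arbitrary: r A g)
  case (Cons h hs)
  obtain p where p: "pos_form (r - 1) {m\<in>A. m + h \<in> A} p" "\<And>m. g (m + h) - g m = h * p m"
    using pos_form_diff[of r A g h] Cons.prems by auto
  have "length hs \<le> r - 1" using Cons.prems by simp
  from Cons.IH[OF p(1) this]
  obtain q where "pos_form (r - 1 - length hs) (diff_domain (h # hs) A) q"
      "\<And>m. iter_diff hs p m = prod_list hs * q m"
    by auto
  then show ?case using p(2) by (auto simp: iter_diff_mult intro!: exI[of _ q])
qed auto

section \<open>Arithmetic of the iterated differences and the size of their fibres\<close>

lemma iter_diff_nonzero:
  assumes "pos_form r A g" "length hs \<le> r" "0 \<notin> set hs" "m \<in> diff_domain hs A"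
  shows "iter_diff hs g m \<noteq> 0"
proof -
  obtain q where "pos_form (r - length hs) (diff_domain hs A) q"
      "iter_diff hs g m = prod_list hs * q m"
    using pos_form_iter_diff assms by blast
  then show ?thesis using pos_form_pos assms by (force simp: prod_list_zero_iff)
qed

lemma dvd_iter_diff:
  assumes "pos_form r A g" "length hs \<le> r" "h \<in> set hs"
  shows "h dvd iter_diff hs g m"
proof -
  have "h dvd prod_list hs" using assms(3) by (induction hs) auto
  then show ?thesis using pos_form_iter_diff[OF assms(1,2)] by auto
qed

text \<open>Equal values at a \<noteq> b would make the difference with the further nonzero shift
  \<open>b - a\<close> vanish at \<open>a\<close>. The strict bound on \<open>length hs\<close>
  leaves room for that extra shift.\<close>

lemma inj_on_iter_diff:
  assumes "pos_form r A g" "length hs < r" "0 \<notin> set hs"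
  shows "inj_on (iter_diff hs g) (diff_domain hs A)"
proof (rule inj_onI, rule ccontr)
  fix a b assume *: "a \<in> diff_domain hs A" "b \<in> diff_domain hs A"
    "iter_diff hs g a = iter_diff hs g b" "a \<noteq> b"
  have "iter_diff (hs @ [b - a]) g a \<noteq> 0"
    by (rule iter_diff_nonzero[OF assms(1)]) (use assms * in \<open>auto simp: diff_domain_snoc\<close>)
  then show False using * by (simp add: iter_diff_snoc)
qed

text \<open>The factor 2 accounts for the two signs of an integer divisor.\<close>

lemma card_divisor_lists_le:
  fixes H :: int
  assumes "H \<noteq> 0"
  shows "finite {hs. set hs \<subseteq> {h. h dvd H} \<and> length hs = k}"
    and "card {hs. set hs \<subseteq> {h. h dvd H} \<and> length hs = k}
           \<le> (2 * card {d::nat. d dvd nat \<bar>H\<bar>}) ^ k"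
proof -
  let ?D = "{d::nat. d dvd nat \<bar>H\<bar>}"
  have fD: "finite ?D" using assms by (intro finite_divisors_nat) auto
  have sub: "{h. h dvd H} \<subseteq> int ` ?D \<union> (\<lambda>d. - int d) ` ?D"
  proof
    fix h assume h: "h \<in> {h. h dvd H}"
    then have "nat \<bar>h\<bar> \<in> ?D" by (simp add: nat_dvd_iff)
    moreover have "h = int (nat \<bar>h\<bar>) \<or> h = - int (nat \<bar>h\<bar>)" by linarith
    ultimately show "h \<in> int ` ?D \<union> (\<lambda>d. - int d) ` ?D" by blast
  qed
  then have fin: "finite {h. h dvd H}" using fD by (auto intro: finite_subset)
  have "card {h. h dvd H} \<le> card (int ` ?D \<union> (\<lambda>d. - int d) ` ?D)"
    using sub fD by (intro card_mono) auto
  also have "\<dots> \<le> card (int ` ?D) + card ((\<lambda>d. - int d) ` ?D)" by (rule card_Un_le)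
  also have "\<dots> \<le> 2 * card ?D"
    using card_image_le[OF fD, of int] card_image_le[OF fD, of "\<lambda>d. - int d"] by linarith
  finally have "card {h. h dvd H} \<le> 2 * card ?D" .
  then show "card {hs. set hs \<subseteq> {h. h dvd H} \<and> length hs = k} \<le> (2 * card ?D) ^ k"
    unfolding card_lists_length_eq[OF fin] by (rule power_mono) simp
  show "finite {hs. set hs \<subseteq> {h. h dvd H} \<and> length hs = k}"
    by (rule finite_lists_length_eq[OF fin])
qed

text \<open>On a fibre the shifts determine \<open>m\<close> by injectivity, and every shift divides
  \<open>H\<close>; so projecting to the shifts embeds the fibre into the lists of \<open>k\<close>
  divisors of \<open>H\<close>.\<close>

lemma card_iter_diff_fibre_le:
  assumes "pos_form r A g" "k < r" "H \<noteq> 0" 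
    and "\<And>hs m. (hs, m) \<in> \<Omega> \<Longrightarrow> length hs = k \<and> 0 \<notin> set hs \<and> m \<in> diff_domain hs A"
  shows "card {w\<in>\<Omega>. (case w of (hs, m) \<Rightarrow> iter_diff hs g m) = H}
           \<le> (2 * card {d::nat. d dvd nat \<bar>H\<bar>}) ^ k"
proof -
  let ?F = "{w\<in>\<Omega>. (case w of (hs, m) \<Rightarrow> iter_diff hs g m) = H}"
  have inj: "inj_on fst ?F"
  proof (rule inj_onI, clarsimp)
    fix hs a b assume "(hs, a) \<in> \<Omega>" "(hs, b) \<in> \<Omega>" "iter_diff hs g b = iter_diff hs g a"
    then show "a = b" using inj_on_iter_diff[OF assms(1), of hs] assms(2,4) by (metis inj_onD)
  qed
  have "fst ` ?F \<subseteq> {hs. set hs \<subseteq> {h. h dvd H} \<and> length hs = k}"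
    using assms(2,4) dvd_iter_diff[OF assms(1)] by fastforce
  from card_mono[OF card_divisor_lists_le(1)[OF assms(3)] this]
  have "card ?F \<le> card {hs. set hs \<subseteq> {h. h dvd H} \<and> length hs = k}"
    unfolding card_image[OF inj] .
  then show ?thesis using card_divisor_lists_le(2)[OF assms(3), of k] by linarith
qed

subsection \<open>Weyl differencing\<close>

lemma e_add: "e (a + b) = e a * e b"
  by (simp add: e_def distrib_left exp_add)

lemma cnj_e: "cnj (e a) = e (- a)"
  by (simp add: e_def exp_cnj)

lemma norm_e [simp]: "cmod (e a) = 1"
  by (simp add: e_def norm_exp_eq_Re)

lemma continuous_on_e [continuous_intros]: "continuous_on S f \<Longrightarrow> continuous_on S (\<lambda>x. e (f x))"
  unfolding e_def by (intro continuous_intros)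

lemma e_of_int [simp]: "e (of_int a) = 1"
  using exp_integer_2pi[of "of_int a"] by (simp add: e_def mult_ac)

text \<open>Orthogonality of the characters: for a \<noteq> 0 the antiderivative takes the same
  value at 0 and 1.\<close>

lemma has_integral_e_of_int:
  "((\<lambda>\<alpha>. e (\<alpha> * of_int a)) has_integral (if a = 0 then 1 else 0)) {0..1}"
proof (cases "a = 0")
  case True
  then show ?thesis using has_integral_const_real[of "1::complex" 0 1] by (simp add: e_def)
next
  case False
  define c where "c = 2 * of_real pi * \<i> * (of_int a :: complex)"
  have c: "c \<noteq> 0" using False by (simp add: c_def)
  have ec: "e (\<alpha> * of_int a) = exp (c * of_real \<alpha>)" for \<alpha>
    by (simp add: e_def c_def mult_ac)
  have "((\<lambda>\<alpha>. exp (c * of_real \<alpha>)) has_integral (exp (c * of_real 1) / c - exp (c * of_real 0) / c)) {0..1}"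
    by (rule fundamental_theorem_of_calculus)
       (auto intro!: derivative_eq_intros has_vector_derivative_real_field simp: c)
  moreover have "exp c = 1" using ec[of 1] by simp
  ultimately show ?thesis using False by (simp add: ec)
qed

section \<open>Power means and Weyl's inequality\<close>

text \<open>Hoelder's inequality for an exponent \<open>2 ^ j\<close>, by repeated Cauchy-Schwarz.
  The first squaring costs one factor \<open>card A\<close>, which the remaining power raises to
  \<open>2 ^ j\<close>, and 2^j + (2^j - 1) = 2^(j+1) - 1.\<close>

lemma power_mean_two_power:
  fixes a :: "'a \<Rightarrow> real"
  assumes "\<And>h. h \<in> A \<Longrightarrow> a h \<ge> 0"
  shows "(\<Sum>h\<in>A. a h) ^ (2 ^ j) \<le> real (card A) ^ (2 ^ j - 1) * (\<Sum>h\<in>A. a h ^ (2 ^ j))"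
  using assms
proof (induction j arbitrary: a)
  case (Suc j)
  have "(\<Sum>h\<in>A. a h) ^ (2 ^ Suc j) = ((\<Sum>h\<in>A. a h)\<^sup>2) ^ (2 ^ j)"
    by (simp add: power_mult)
  also have "\<dots> \<le> ((\<Sum>h\<in>A. (a h)\<^sup>2) * card A) ^ (2 ^ j)"
    by (intro power_mono sum_squared_le_sum_of_squares) auto
  also have "\<dots> = real (card A) ^ (2 ^ j) * (\<Sum>h\<in>A. (a h)\<^sup>2) ^ (2 ^ j)"
    by (simp add: power_mult_distrib)
  also have "\<dots> \<le> real (card A) ^ (2 ^ j) *
                   (real (card A) ^ (2 ^ j - 1) * (\<Sum>h\<in>A. ((a h)\<^sup>2) ^ (2 ^ j)))"
    by (intro mult_left_mono Suc.IH) auto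
  also have "\<dots> = real (card A) ^ (2 ^ j + (2 ^ j - 1)) * (\<Sum>h\<in>A. a h ^ (2 ^ Suc j))"
    by (simp only: power_add mult.assoc power_mult power_Suc)
  also have "2 ^ j + (2 ^ j - 1) = 2 ^ Suc j - (1::nat)" by simp
  finally show ?case .
qed simp

lemma sum_lists_Suc:
  assumes "finite A"
  shows "(\<Sum>hs\<in>{hs. set hs \<subseteq> A \<and> length hs = Suc j}. F hs)
           = (\<Sum>h\<in>A. \<Sum>hs\<in>{hs. set hs \<subseteq> A \<and> length hs = j}. F (h # hs))"
proof -
  let ?L = "{hs. set hs \<subseteq> A \<and> length hs = j}"
  have "(\<Sum>hs\<in>{hs. set hs \<subseteq> A \<and> length hs = Suc j}. F hs) = (\<Sum>(hs, h)\<in>?L \<times> A. F (h # hs))"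
    unfolding lists_length_Suc_eq
    by (subst sum.reindex) (auto simp: inj_on_def intro!: sum.cong)
  also have "\<dots> = (\<Sum>hs\<in>?L. \<Sum>h\<in>A. F (h # hs))" by (simp add: sum.cartesian_product)
  also have "\<dots> = (\<Sum>h\<in>A. \<Sum>hs\<in>?L. F (h # hs))" by (rule sum.swap)
  finally show ?thesis .
qed

text \<open>The shift set \<open>A\<close> stays fixed while \<open>I\<close> shrinks from level to
  level: a shift that is no difference of two elements of \<open>I\<close> merely contributes an
  empty sum.\<close>

definition weyl_sum :: "int set \<Rightarrow> nat \<Rightarrow> int set \<Rightarrow> (int \<Rightarrow> real) \<Rightarrow> complex" where
  "weyl_sum A j I f =
     (\<Sum>hs\<in>{hs. set hs \<subseteq> A \<and> length hs = j}. \<Sum>m\<in>diff_domain hs I. e (iter_diff hs f m))"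

lemma weyl_sum_Suc:
  "finite A \<Longrightarrow> weyl_sum A (Suc j) I f =
     (\<Sum>h\<in>A. weyl_sum A j {m\<in>I. m + h \<in> I} (\<lambda>m. f (m + h) - f m))"
  by (simp add: weyl_sum_def sum_lists_Suc)

lemma weyl_sum_0: "weyl_sum A 0 I f = (\<Sum>m\<in>I. e (f m))"
proof -
  have "{hs. set hs \<subseteq> A \<and> length hs = 0} = {[]}" by auto
  then show ?thesis by (simp add: weyl_sum_def)
qed

text \<open>Expand the square as a double sum over \<open>m'\<close> and \<open>m\<close>, and
  substitute m' = m + h.\<close>

lemma norm_exp_sum_square:
  fixes I :: "int set"
  assumes "finite A" "finite I" "\<And>m m'. m \<in> I \<Longrightarrow> m' \<in> I \<Longrightarrow> m' - m \<in> A"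
  shows "complex_of_real ((cmod (\<Sum>m\<in>I. e (f m)))\<^sup>2)
           = (\<Sum>h\<in>A. \<Sum>m\<in>{m\<in>I. m + h \<in> I}. e (f (m + h) - f m))"
proof -
  have "complex_of_real ((cmod (\<Sum>m\<in>I. e (f m)))\<^sup>2) = (\<Sum>m\<in>I. e (f m)) * cnj (\<Sum>m\<in>I. e (f m))"
    by (rule complex_norm_square)
  also have "\<dots> = (\<Sum>m'\<in>I. \<Sum>m\<in>I. e (f m' - f m))"
    by (simp add: cnj_e sum_product flip: e_add)
  also have "\<dots> = (\<Sum>m\<in>I. \<Sum>m'\<in>I. e (f m' - f m))"
    by (rule sum.swap)
  also have "\<dots> = (\<Sum>m\<in>I. \<Sum>h\<in>{h\<in>A. m + h \<in> I}. e (f (m + h) - f m))"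
  proof (rule sum.cong[OF refl])
    fix m assume "m \<in> I"
    then show "(\<Sum>m'\<in>I. e (f m' - f m)) = (\<Sum>h\<in>{h\<in>A. m + h \<in> I}. e (f (m + h) - f m))"
      using assms(3)
      by (intro sum.reindex_bij_witness[of _ "\<lambda>h. m + h" "\<lambda>m'. m' - m"]) auto
  qed
  also have "\<dots> = (\<Sum>h\<in>A. \<Sum>m\<in>{m\<in>I. m + h \<in> I}. e (f (m + h) - f m))"
    by (rule sum.swap_restrict[OF assms(2,1)])
  finally show ?thesis .
qed

text \<open>Ensures that exponents such as \<open>2 ^ Suc j - Suc j - 1\<close> are not
  truncated.\<close>

lemma Suc_Suc_le_two_power_Suc: "Suc j + 1 \<le> 2 ^ Suc j"
  by (induction j) auto

text \<open>One squaring yields a sum over \<open>h\<close> of exponential sums for the differenced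
  phase on a subset of \<open>I\<close>. Hoelder across \<open>h\<close> moves the power
  \<open>2 ^ Suc j\<close> inside, where the induction hypothesis applies to each \<open>h\<close>.
  For a single squaring the relation is an equality.\<close>

lemma weyl_inequality:
  assumes "finite A" "finite I" "\<And>m m'. m \<in> I \<Longrightarrow> m' \<in> I \<Longrightarrow> m' - m \<in> A"
  shows "cmod (\<Sum>m\<in>I. e (f m)) ^ (2 ^ Suc j)
           \<le> real (card A) ^ (2 ^ Suc j - Suc j - 1) * Re (weyl_sum A (Suc j) I f)"
  using assms(2,3)
proof (induction j arbitrary: I f)
  case 0
  have "complex_of_real ((cmod (\<Sum>m\<in>I. e (f m)))\<^sup>2) = weyl_sum A (Suc 0) I f"
    using norm_exp_sum_square[OF assms(1) 0] by (simp add: weyl_sum_Suc assms(1) weyl_sum_0)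
  then have "(cmod (\<Sum>m\<in>I. e (f m)))\<^sup>2 = Re (weyl_sum A (Suc 0) I f)"
    by (metis Re_complex_of_real)
  then show ?case by simp
next
  case (Suc j)
  define I' where "I' h = {m\<in>I. m + h \<in> I}" for h
  define f' where "f' h = (\<lambda>m. f (m + h) - f m)" for h
  define s where "s h = (\<Sum>m\<in>I' h. e (f' h m))" for h
  let ?N = "real (card A)"
  \<comment> \<open>The first exponent of \<open>card A\<close> comes from Hoelder, the second from
    the induction hypothesis.\<close>
  have exps: "(2 ^ Suc j - 1) + (2 ^ Suc j - Suc j - 1) = 2 ^ Suc (Suc j) - Suc (Suc j) - (1::nat)"
    using Suc_Suc_le_two_power_Suc[of j] by simp
  have "(cmod (\<Sum>m\<in>I. e (f m)))\<^sup>2 = cmod (complex_of_real ((cmod (\<Sum>m\<in>I. e (f m)))\<^sup>2))"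
    by (simp only: norm_of_real abs_power2)
  also have "\<dots> = cmod (\<Sum>h\<in>A. s h)"
    using norm_exp_sum_square[OF assms(1) Suc.prems] by (simp only: s_def I'_def f'_def)
  also have "\<dots> \<le> (\<Sum>h\<in>A. cmod (s h))" by (rule norm_sum)
  finally have "((cmod (\<Sum>m\<in>I. e (f m)))\<^sup>2) ^ (2 ^ Suc j) \<le> (\<Sum>h\<in>A. cmod (s h)) ^ (2 ^ Suc j)"
    by (intro power_mono) auto
  also have "\<dots> \<le> ?N ^ (2 ^ Suc j - 1) * (\<Sum>h\<in>A. cmod (s h) ^ (2 ^ Suc j))"
    by (rule power_mean_two_power) auto
  also have "\<dots> \<le> ?N ^ (2 ^ Suc j - 1) *
      (\<Sum>h\<in>A. ?N ^ (2 ^ Suc j - Suc j - 1) * Re (weyl_sum A (Suc j) (I' h) (f' h)))"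
    unfolding s_def using Suc.prems
    by (intro mult_left_mono sum_mono Suc.IH) (auto simp: I'_def)
  also have "\<dots> = ?N ^ ((2 ^ Suc j - 1) + (2 ^ Suc j - Suc j - 1)) * Re (weyl_sum A (Suc (Suc j)) I f)"
    unfolding power_add weyl_sum_Suc[OF assms(1), of "Suc j"] I'_def f'_def
    by (simp only: Re_sum sum_distrib_left mult.assoc)
  finally have "((cmod (\<Sum>m\<in>I. e (f m)))\<^sup>2) ^ (2 ^ Suc j)
      \<le> ?N ^ (2 ^ Suc (Suc j) - Suc (Suc j) - 1) * Re (weyl_sum A (Suc (Suc j)) I f)"
    unfolding exps .
  then show ?case by (simp add: power_mult[symmetric])
qed

text \<open>Lists avoiding \<open>z\<close> are lists over \<open>A - {z}\<close>, so with N =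
  \<open>card A\<close> the count is N^k - (N - 1)^k, which Bernoulli's inequality at -1/N bounds by
  k N^(k-1).\<close>

lemma card_lists_containing_le:
  assumes "finite A" "z \<in> A"
  shows "real (card {hs. set hs \<subseteq> A \<and> length hs = k \<and> z \<in> set hs}) \<le> real k * real (card A) ^ (k - 1)"
proof -
  let ?L = "{hs. set hs \<subseteq> A \<and> length hs = k}" and ?M = "{hs. set hs \<subseteq> A - {z} \<and> length hs = k}"
  have a: "card A \<ge> 1" using assms card_gt_0_iff[of A] by fastforce
  have *: "{hs. set hs \<subseteq> A \<and> length hs = k \<and> z \<in> set hs} = ?L - ?M" by auto
  have "card {hs. set hs \<subseteq> A \<and> length hs = k \<and> z \<in> set hs} = card A ^ k - (card A - 1) ^ k"
  proof -
    have "finite ?M" "?M \<subseteq> ?L" 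
      using assms by (auto intro!: finite_lists_length_eq)
    then have "card (?L - ?M) = card ?L - card ?M" by (rule card_Diff_subset)
    also have "\<dots> = card A ^ k - card (A - {z}) ^ k"
      using assms by (simp only: card_lists_length_eq finite_Diff)
    finally show ?thesis using assms * by simp
  qed
  then have "real (card {hs. set hs \<subseteq> A \<and> length hs = k \<and> z \<in> set hs})
       = real (card A) ^ k - (real (card A) - 1) ^ k"
    using a by (simp add: of_nat_diff power_mono)
  also have "\<dots> \<le> real k * real (card A) ^ (k - 1)"
  proof (cases k)
    case (Suc j)
    have "1 - real k / real (card A) \<le> (1 - 1 / real (card A)) ^ k"
      using Bernoulli_inequality[of "- 1 / real (card A)" k] a by (simp add: field_simps)
    then have "real (card A) ^ k * (1 - real k / real (card A)) \<le> real (card A) ^ k * (1 - 1 / real (card A)) ^ k"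
      by (intro mult_left_mono) auto
    also have "\<dots> = (real (card A) - 1) ^ k"
      using a by (simp add: right_diff_distrib flip: power_mult_distrib)
    finally have "real (card A) ^ k - (real (card A) - 1) ^ k \<le> real (card A) ^ k * (real k / real (card A))"
      by (simp add: right_diff_distrib)
    also have "\<dots> = real k * real (card A) ^ (k - 1)" using a Suc by simp
    finally show ?thesis .
  qed simp
  finally show ?thesis .
qed

subsection \<open>Moments of exponential sums\<close>

text \<open>Frequencies form a list with repetitions instead of a coefficient function: a product
  becomes a list of pairwise sums, and the length counts the terms.\<close>

definition trig_poly :: "int list \<Rightarrow> real \<Rightarrow> complex" where
  "trig_poly L \<alpha> = (\<Sum>a\<leftarrow>L. e (\<alpha> * of_int a))"

lemma trig_poly_simps [simp]:
  "trig_poly [] \<alpha> = 0"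
  "trig_poly (a # L) \<alpha> = e (\<alpha> * of_int a) + trig_poly L \<alpha>"
  "trig_poly (L @ M) \<alpha> = trig_poly L \<alpha> + trig_poly M \<alpha>"
  by (simp_all add: trig_poly_def)

lemma trig_poly_shift: "trig_poly (map ((+) a) M) \<alpha> = e (\<alpha> * of_int a) * trig_poly M \<alpha>"
  by (induction M) (simp_all add: distrib_left e_add)

lemma trig_poly_mult:
  "trig_poly L \<alpha> * trig_poly M \<alpha> = trig_poly (concat (map (\<lambda>a. map ((+) a) M) L)) \<alpha>"
  by (induction L) (simp_all add: trig_poly_shift distrib_right)

lemma length_concat_shift: "length (concat (map (\<lambda>a. map ((+) a) M) L)) = length L * length M"
  by (induction L) simp_all

lemma cnj_trig_poly: "cnj (trig_poly L \<alpha>) = trig_poly (map uminus L) \<alpha>"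
  by (induction L) (simp_all add: cnj_e)

lemma T_eq_trig_poly: "T n \<alpha> x y = trig_poly (map (\<lambda>m. m ^ n) [int x - int y + 1..int x]) \<alpha>"
proof -
  have "{int x - int y<..int x} = set [int x - int y + 1..int x]" by auto
  then show ?thesis
    by (simp add: T_def trig_poly_def sum_list_distinct_conv_sum_set o_def)
qed

text \<open>\<open>T\<close> times its conjugate has y^2 frequencies, and each further squaring
  squares the length of the list.\<close>

lemma norm_T_power_eq_trig_poly:
  "\<exists>L. length L = y ^ (2 ^ Suc k) \<and> (\<forall>\<alpha>. complex_of_real (cmod (T n \<alpha> x y) ^ (2 ^ Suc k)) = trig_poly L \<alpha>)"
proof (induction k)
  case 0
  let ?L = "map (\<lambda>m. m ^ n) [int x - int y + 1..int x]"
  have "complex_of_real (cmod (T n \<alpha> x y) ^ 2)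
      = trig_poly (concat (map (\<lambda>a. map ((+) a) (map uminus ?L)) ?L)) \<alpha>" for \<alpha>
    unfolding complex_norm_square T_eq_trig_poly cnj_trig_poly trig_poly_mult ..
  moreover have "length (concat (map (\<lambda>a. map ((+) a) (map uminus ?L)) ?L)) = y ^ 2"
    unfolding length_concat_shift by (simp add: power2_eq_square)
  moreover have "2 ^ Suc 0 = (2::nat)" by simp
  ultimately show ?case by (simp only:) blast
next
  case (Suc k)
  then obtain L where L: "length L = y ^ (2 ^ Suc k)"
     "\<And>\<alpha>. complex_of_real (cmod (T n \<alpha> x y) ^ (2 ^ Suc k)) = trig_poly L \<alpha>" by blast
  have two: "(z::'a::comm_monoid_mult) ^ (2 ^ Suc (Suc k)) = z ^ (2 ^ Suc k) * z ^ (2 ^ Suc k)" for z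
    by (simp only: power_Suc mult_2 power_add)
  have "complex_of_real (cmod (T n \<alpha> x y) ^ (2 ^ Suc (Suc k)))
      = trig_poly (concat (map (\<lambda>a. map ((+) a) L) L)) \<alpha>" for \<alpha>
    unfolding two of_real_mult L(2) trig_poly_mult ..
  moreover have "length (concat (map (\<lambda>a. map ((+) a) L) L)) = y ^ (2 ^ Suc (Suc k))"
    unfolding length_concat_shift L(1) two ..
  ultimately show ?case by blast
qed

text \<open>By orthogonality the integral counts the solutions of a + \<phi>(w) = 0, with the
  frequencies \<open>a\<close> taken with multiplicity.\<close>

lemma has_integral_trig_poly_mult:
  assumes "finite \<Omega>"
  shows "((\<lambda>\<alpha>. trig_poly L \<alpha> * (\<Sum>w\<in>\<Omega>. e (\<alpha> * of_int (\<phi> w)))) has_integral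
           of_nat (\<Sum>a\<leftarrow>L. card {w\<in>\<Omega>. \<phi> w = - a})) {0..1}"
proof (induction L)
  case (Cons a L)
  have "((\<lambda>\<alpha>. \<Sum>w\<in>\<Omega>. e (\<alpha> * of_int (a + \<phi> w))) has_integral
          (\<Sum>w\<in>\<Omega>. if a + \<phi> w = 0 then 1 else 0)) {0..1}"
    using assms by (intro has_integral_sum has_integral_e_of_int)
  moreover have "(\<Sum>w\<in>\<Omega>. if a + \<phi> w = 0 then 1 else 0) = (of_nat (card {w\<in>\<Omega>. \<phi> w = - a}) :: complex)"
  proof -
    have "{w\<in>\<Omega>. \<phi> w = - a} = {w\<in>\<Omega>. a + \<phi> w = 0}" by auto
    then show ?thesis using assms by (simp add: sum.If_cases Int_def)
  qed
  moreover have "(\<Sum>w\<in>\<Omega>. e (\<alpha> * of_int (a + \<phi> w)))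
      = e (\<alpha> * of_int a) * (\<Sum>w\<in>\<Omega>. e (\<alpha> * of_int (\<phi> w)))" for \<alpha>
    by (simp add: sum_distrib_left distrib_left e_add)
  ultimately have "((\<lambda>\<alpha>. e (\<alpha> * of_int a) * (\<Sum>w\<in>\<Omega>. e (\<alpha> * of_int (\<phi> w)))) has_integral
      of_nat (card {w\<in>\<Omega>. \<phi> w = - a})) {0..1}"
    by (simp only:)
  from has_integral_add[OF this Cons] show ?case by (simp add: distrib_right)
qed simp

section \<open>Moments of \<open>T\<close> and the passage from order \<open>2 ^ k\<close> to
  \<open>2 ^ Suc k\<close>\<close>

definition moment :: "nat \<Rightarrow> nat \<Rightarrow> nat \<Rightarrow> nat \<Rightarrow> real" where
  "moment n k x y = integral {0..1} (\<lambda>\<alpha>. cmod (T n \<alpha> x y) ^ (2 ^ k))"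

lemma has_integral_moment:
  "((\<lambda>\<alpha>. cmod (T n \<alpha> x y) ^ (2 ^ k)) has_integral moment n k x y) {0..1}"
  unfolding moment_def T_def
  by (intro integrable_integral integrable_continuous_interval continuous_intros)

lemma moment_nonneg: "moment n k x y \<ge> 0"
  by (rule has_integral_nonneg[OF has_integral_moment]) simp

lemma T_eq_sum: "T n \<alpha> x y = (\<Sum>m\<in>{int x - int y<..int x}. e (\<alpha> * of_int (m ^ n)))"
  by (simp add: T_def)

text \<open>Parseval: only pairs with m^n = m'^n survive the integration. Since y \<le> x the range
  is positive, where the \<open>n\<close>-th power is injective, and the \<open>y\<close> diagonal
  pairs remain.\<close>

lemma moment_one_le:
  assumes "y \<le> x" "n > 0"
  shows "moment n 1 x y \<le> real y"
proof -
  let ?I = "{int x - int y<..int x}"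
  have sq: "complex_of_real (cmod (T n \<alpha> x y) ^ (2 ^ 1)) = (\<Sum>m\<in>?I. \<Sum>m'\<in>?I. e (\<alpha> * of_int (m ^ n - m' ^ n)))" for \<alpha>
  proof -
    have "complex_of_real (cmod (T n \<alpha> x y) ^ (2 ^ 1)) = T n \<alpha> x y * cnj (T n \<alpha> x y)"
      by (simp only: power_one_right complex_norm_square)
    also have "\<dots> = (\<Sum>m\<in>?I. \<Sum>m'\<in>?I. e (\<alpha> * of_int (m ^ n - m' ^ n)))"
      by (simp add: T_eq_sum sum_product cnj_e right_diff_distrib flip: e_add)
    finally show ?thesis .
  qed
  have "((\<lambda>\<alpha>. \<Sum>m\<in>?I. \<Sum>m'\<in>?I. e (\<alpha> * of_int (m ^ n - m' ^ n))) has_integral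
          (\<Sum>m\<in>?I. \<Sum>m'\<in>?I. if m ^ n - m' ^ n = 0 then 1 else 0)) {0..1}"
    by (intro has_integral_sum has_integral_e_of_int) auto
  moreover have "(\<Sum>m\<in>?I. \<Sum>m'\<in>?I. if m ^ n - m' ^ n = 0 then 1 else 0) = complex_of_real (real y)"
  proof -
    have "(\<Sum>m'\<in>?I. if m ^ n - m' ^ n = 0 then 1 else 0) = (1::complex)" if "m \<in> ?I" for m
    proof -
      have "m ^ n - m' ^ n = 0 \<longleftrightarrow> m = m'" if "m' \<in> ?I" for m'
        using that \<open>m \<in> ?I\<close> assms by (auto intro: power_eq_imp_eq_base[of m n m'])
      then have "(\<Sum>m'\<in>?I. if m ^ n - m' ^ n = 0 then 1 else 0) = (\<Sum>m'\<in>?I. if m = m' then 1 else (0::complex))"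
        by (intro sum.cong) auto
      then show ?thesis using that by simp
    qed
    then show ?thesis by simp
  qed
  ultimately have "((\<lambda>\<alpha>. complex_of_real (cmod (T n \<alpha> x y) ^ (2 ^ 1))) has_integral complex_of_real (real y)) {0..1}"
    by (simp only: sq)
  from has_integral_linear[OF this bounded_linear_Re]
  have "((\<lambda>\<alpha>. cmod (T n \<alpha> x y) ^ (2 ^ 1)) has_integral real y) {0..1}" by (simp add: o_def)
  with has_integral_moment[of n x y 1] have "moment n 1 x y = real y"
    by (rule has_integral_unique)
  then show ?thesis by simp
qed

lemma sum_list_le_length_mult:
  fixes M :: real
  assumes "\<And>a. f a \<le> M"
  shows "(\<Sum>a\<leftarrow>L. f a) \<le> real (length L) * M"
  by (induction L) (use assms in \<open>auto simp: distrib_right intro: add_mono\<close>)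

text \<open>Weyl's inequality with the shift lists split by whether 0 occurs. Those containing 0
  number at most k (2y)^(k-1), and each inner sum is trivially at most \<open>y\<close>; the others
  are kept as an exponential sum.\<close>

lemma norm_T_power_le:
  fixes n k x y :: nat
  defines "I \<equiv> {int x - int y<..int x}" and "A \<equiv> {- int y<..<int y}"
  defines "L \<equiv> {hs. set hs \<subseteq> A \<and> length hs = k}"
  assumes "k \<ge> 1" "y > 0"
  shows "cmod (T n \<alpha> x y) ^ (2 ^ k) \<le> (2 * real y) ^ (2 ^ k - k - 1) *
           (real k * (2 * real y) ^ (k - 1) * real y +
            Re (\<Sum>(hs, m)\<in>(SIGMA hs:{hs\<in>L. 0 \<notin> set hs}. diff_domain hs I).
                  e (\<alpha> * of_int (iter_diff hs (\<lambda>m. m ^ n) m))))"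
proof -
  define f where "f m = \<alpha> * of_int (m ^ n)" for m :: int
  define F where "F hs = (\<Sum>m\<in>diff_domain hs I. e (iter_diff hs f m))" for hs
  have fin: "finite A" "finite I" by (simp_all add: A_def I_def)
  have finL: "finite L" unfolding L_def by (rule finite_lists_length_eq[OF fin(1)])
  have finD: "finite (diff_domain hs I)" for hs
    using fin(2) diff_domain_subset finite_subset by blast
  have f: "iter_diff hs f m = \<alpha> * of_int (iter_diff hs (\<lambda>m. m ^ n) m)" for hs m
    unfolding f_def iter_diff_mult by (simp only: iter_diff_of_int)
  have A: "0 \<in> A" using \<open>y > 0\<close> by (simp add: A_def)
  have cardA: "1 \<le> real (card A)" "real (card A) \<le> 2 * real y"
    using \<open>y > 0\<close> by (auto simp: A_def)
  have "weyl_sum A k I f = (\<Sum>hs\<in>{hs\<in>L. 0 \<in> set hs}. F hs) + (\<Sum>hs\<in>{hs\<in>L. 0 \<notin> set hs}. F hs)"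
    unfolding weyl_sum_def F_def[symmetric] L_def[symmetric]
    using finL by (subst sum.union_disjoint[symmetric]) (auto intro!: sum.cong)
  moreover have "(\<Sum>hs\<in>{hs\<in>L. 0 \<notin> set hs}. F hs) =
      (\<Sum>(hs, m)\<in>(SIGMA hs:{hs\<in>L. 0 \<notin> set hs}. diff_domain hs I).
                  e (\<alpha> * of_int (iter_diff hs (\<lambda>m. m ^ n) m)))" (is "_ = ?S")
    unfolding F_def f using finL finD by (subst sum.Sigma) auto
  moreover have "Re (\<Sum>hs\<in>{hs\<in>L. 0 \<in> set hs}. F hs) \<le> real k * (2 * real y) ^ (k - 1) * real y"
  proof -
    have "Re (\<Sum>hs\<in>{hs\<in>L. 0 \<in> set hs}. F hs) \<le> (\<Sum>hs\<in>{hs\<in>L. 0 \<in> set hs}. cmod (F hs))"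
      using complex_Re_le_cmod norm_sum by (rule order_trans)
    also have "\<dots> \<le> (\<Sum>hs\<in>{hs\<in>L. 0 \<in> set hs}. real y)"
    proof (rule sum_mono)
      fix hs
      have "cmod (F hs) \<le> real (card (diff_domain hs I))"
        unfolding F_def by (rule order_trans[OF norm_sum]) simp
      also have "\<dots> \<le> real (card I)"
        using card_mono[OF fin(2) diff_domain_subset] by simp
      finally show "cmod (F hs) \<le> real y" by (simp add: I_def)
    qed
    also have "\<dots> = real (card {hs. set hs \<subseteq> A \<and> length hs = k \<and> 0 \<in> set hs}) * real y"
      by (simp add: L_def conj_assoc)
    also have "\<dots> \<le> (real k * real (card A) ^ (k - 1)) * real y"
      by (intro mult_right_mono card_lists_containing_le fin A) simp
    also have "\<dots> \<le> (real k * (2 * real y) ^ (k - 1)) * real y"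
      using cardA by (intro mult_right_mono mult_left_mono power_mono) auto
    finally show ?thesis .
  qed
  ultimately have Re_le: "Re (weyl_sum A k I f) \<le> real k * (2 * real y) ^ (k - 1) * real y + Re ?S"
    by simp
  have ineq: "cmod (T n \<alpha> x y) ^ (2 ^ k) \<le> real (card A) ^ (2 ^ k - k - 1) * Re (weyl_sum A k I f)"
    using weyl_inequality[OF fin, of f "k - 1"] \<open>k \<ge> 1\<close>
    by (auto simp: T_eq_sum f_def I_def A_def)
  \<comment> \<open>Replacing \<open>card A\<close> by 2y in the prefactor needs a nonnegative Weyl
    sum; that follows from the inequality itself, whose left side is nonnegative.\<close>
  have "0 \<le> real (card A) ^ (2 ^ k - k - 1) * Re (weyl_sum A k I f)"
    by (rule order_trans[OF _ ineq]) simp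
  moreover have "real (card A) ^ (2 ^ k - k - 1) > 0" using cardA by (intro zero_less_power) linarith
  ultimately have "0 \<le> Re (weyl_sum A k I f)"
    by (simp only: zero_le_mult_iff) linarith
  then have "real (card A) ^ (2 ^ k - k - 1) * Re (weyl_sum A k I f)
      \<le> (2 * real y) ^ (2 ^ k - k - 1) * Re (weyl_sum A k I f)"
    using cardA by (intro mult_right_mono power_mono) auto
  also have "\<dots> \<le> (2 * real y) ^ (2 ^ k - k - 1) * (real k * (2 * real y) ^ (k - 1) * real y + Re ?S)"
    using Re_le by (intro mult_left_mono) auto
  finally show ?thesis using ineq by linarith
qed

text \<open>The pointwise bound is multiplied by a second factor |T|^(2^k) and integrated. Lists
  with a zero shift reproduce the moment of order \<open>2 ^ k\<close>. For the others, each of the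
  \<open>y ^ (2 ^ k)\<close> frequencies of that factor matches at most \<open>M\<close> pairs of
  shifts and \<open>m\<close>.\<close>

lemma moment_Suc_le:
  fixes n k x y :: nat and M :: real
  assumes "1 \<le> k" "k < n" "0 < y" "y \<le> x" "0 \<le> M"
    and M: "\<And>H::int. H \<noteq> 0 \<Longrightarrow> \<bar>H\<bar> \<le> 2 ^ k * int x ^ n \<Longrightarrow>
              real ((2 * card {d::nat. d dvd nat \<bar>H\<bar>}) ^ k) \<le> M"
  shows "moment n (Suc k) x y \<le> (2 * real y) ^ (2 ^ k - k - 1) *
           (real k * (2 * real y) ^ (k - 1) * real y * moment n k x y + real y ^ (2 ^ k) * M)"
proof -
  define I where "I = {int x - int y<..int x}"
  define \<Omega> where "\<Omega> = (SIGMA hs:{hs\<in>{hs. set hs \<subseteq> {- int y<..<int y} \<and> length hs = k}. 0 \<notin> set hs}.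
                        diff_domain hs I)"
  define \<phi> :: "int list \<times> int \<Rightarrow> int" where "\<phi> w = (case w of (hs, m) \<Rightarrow> iter_diff hs (\<lambda>m. m ^ n) m)" for w
  define E where "E = 2 ^ k - k - (1::nat)"
  define Z where "Z = real k * (2 * real y) ^ (k - 1) * real y"
  define c where "c \<alpha> = cmod (T n \<alpha> x y) ^ (2 ^ k)" for \<alpha>
  have finI: "finite I" by (simp add: I_def)
  have fin\<Omega>: "finite \<Omega>"
    unfolding \<Omega>_def
  proof (rule finite_SigmaI)
    show "finite {hs\<in>{hs. set hs \<subseteq> {- int y<..<int y} \<and> length hs = k}. 0 \<notin> set hs}"
      using finite_lists_length_eq[of "{- int y<..<int y}" k] by (rule rev_finite_subset) auto
    show "finite (diff_domain hs I)" for hs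
      using finI diff_domain_subset by (rule rev_finite_subset)
  qed
  have pf: "pos_form n I (\<lambda>m. m ^ n)"
    by (rule pos_form_power) (use \<open>y \<le> x\<close> in \<open>auto simp: I_def\<close>)
  obtain L where L: "length L = y ^ (2 ^ k)" "\<And>\<alpha>. complex_of_real (c \<alpha>) = trig_poly L \<alpha>"
    using norm_T_power_eq_trig_poly[of y "k - 1" n x] \<open>1 \<le> k\<close> by (auto simp: c_def)
  \<comment> \<open>\<open>N\<close> counts coincidences between a frequency of |T|^(2^k) and the
    negative of an iterated difference.\<close>
  define N where "N = (\<Sum>a\<leftarrow>L. card {w\<in>\<Omega>. \<phi> w = - a})"
  have "((\<lambda>\<alpha>. complex_of_real (c \<alpha>) * (\<Sum>w\<in>\<Omega>. e (\<alpha> * of_int (\<phi> w)))) has_integral of_nat N) {0..1}"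
    unfolding L(2) N_def by (rule has_integral_trig_poly_mult[OF fin\<Omega>])
  from has_integral_linear[OF this bounded_linear_Re]
  have offdiag: "((\<lambda>\<alpha>. c \<alpha> * Re (\<Sum>w\<in>\<Omega>. e (\<alpha> * of_int (\<phi> w)))) has_integral real N) {0..1}"
    by (simp add: o_def)
  have diag: "((\<lambda>\<alpha>. Z * c \<alpha>) has_integral Z * moment n k x y) {0..1}"
    unfolding c_def by (intro has_integral_mult_right has_integral_moment)
  have rhs: "((\<lambda>\<alpha>. (2 * real y) ^ E * (Z * c \<alpha> + c \<alpha> * Re (\<Sum>w\<in>\<Omega>. e (\<alpha> * of_int (\<phi> w)))))
      has_integral (2 * real y) ^ E * (Z * moment n k x y + real N)) {0..1}"
    by (intro has_integral_mult_right has_integral_add[OF diag offdiag])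
  have "moment n (Suc k) x y \<le> (2 * real y) ^ E * (Z * moment n k x y + real N)"
  proof (rule has_integral_le[OF has_integral_moment rhs])
    fix \<alpha> :: real
    have "cmod (T n \<alpha> x y) ^ (2 ^ Suc k) = c \<alpha> * c \<alpha>"
      by (simp only: c_def power_Suc mult_2 power_add)
    also have "\<dots> \<le> c \<alpha> * ((2 * real y) ^ E * (Z + Re (\<Sum>w\<in>\<Omega>. e (\<alpha> * of_int (\<phi> w)))))"
      using norm_T_power_le[OF assms(1,3), of n \<alpha> x]
      by (intro mult_left_mono) (auto simp: c_def E_def Z_def \<Omega>_def \<phi>_def I_def case_prod_beta)
    finally show "cmod (T n \<alpha> x y) ^ (2 ^ Suc k)
        \<le> (2 * real y) ^ E * (Z * c \<alpha> + c \<alpha> * Re (\<Sum>w\<in>\<Omega>. e (\<alpha> * of_int (\<phi> w))))"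
      by (simp only: algebra_simps)
  qed
  also have "\<dots> \<le> (2 * real y) ^ E * (Z * moment n k x y + real y ^ (2 ^ k) * M)"
  proof -
    \<comment> \<open>Only a nonempty fibre needs the bound \<open>M\<close>, and one element of it
      shows that \<open>- a\<close> is nonzero and of admissible size.\<close>
    have "real (card {w\<in>\<Omega>. \<phi> w = - a}) \<le> M" for a
    proof (cases "{w\<in>\<Omega>. \<phi> w = - a} = {}")
      case True
      then show ?thesis unfolding True using \<open>0 \<le> M\<close> by simp
    next
      case False
      then obtain hs m where w: "(hs, m) \<in> \<Omega>" "iter_diff hs (\<lambda>m. m ^ n) m = - a"
        by (auto simp: \<phi>_def)
      then have hs: "length hs = k" "0 \<notin> set hs" "m \<in> diff_domain hs I"
        by (auto simp: \<Omega>_def)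
      have "- a \<noteq> 0"
        using iter_diff_nonzero[OF pf _ hs(2,3)] hs(1) \<open>k < n\<close> w(2) by auto
      moreover have "\<bar>- a\<bar> \<le> 2 ^ k * int x ^ n"
      proof -
        have "\<bar>m ^ n\<bar> \<le> int x ^ n" if "m \<in> I" for m
          using that \<open>y \<le> x\<close> by (auto simp: I_def power_abs intro!: power_mono)
        from abs_iter_diff_le[where f = "\<lambda>m. m ^ n", OF this hs(3)] show ?thesis
          using w(2) hs(1) by simp
      qed
      ultimately have "real ((2 * card {d::nat. d dvd nat \<bar>- a\<bar>}) ^ k) \<le> M" by (rule M)
      moreover have "card {w\<in>\<Omega>. \<phi> w = - a} \<le> (2 * card {d::nat. d dvd nat \<bar>- a\<bar>}) ^ k"
        unfolding \<phi>_def using \<open>- a \<noteq> 0\<close>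
        by (intro card_iter_diff_fibre_le[OF pf \<open>k < n\<close>]) (auto simp: \<Omega>_def)
      ultimately show ?thesis by linarith
    qed
    then have "(\<Sum>a\<leftarrow>L. real (card {w\<in>\<Omega>. \<phi> w = - a})) \<le> real (length L) * M"
      by (rule sum_list_le_length_mult)
    moreover have "real N = (\<Sum>a\<leftarrow>L. real (card {w\<in>\<Omega>. \<phi> w = - a}))"
      unfolding N_def by (induction L) auto
    ultimately have "real N \<le> real y ^ (2 ^ k) * M" by (simp add: L(1))
    then show ?thesis by (intro mult_left_mono add_left_mono) auto
  qed
  finally show ?thesis unfolding E_def Z_def .
qed

section \<open>Constants uniform in \<open>x\<close> and \<open>y\<close>, and the final
  induction\<close>

lemma divisor_count_power_bound:
  fixes n k :: nat and \<epsilon> :: real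
  assumes "\<epsilon> > 0" "k \<ge> 1" "n \<ge> 1"
  shows "\<exists>C>0. \<forall>(x::nat) (y::nat) H. 0 < y \<longrightarrow> x \<le> y ^ 2 \<longrightarrow> H \<noteq> 0 \<longrightarrow> \<bar>H\<bar> \<le> 2 ^ k * int x ^ n \<longrightarrow>
           real ((2 * card {d::nat. d dvd nat \<bar>H\<bar>}) ^ k) \<le> C * real y powr \<epsilon>"
proof -
  \<comment> \<open>As |H| \<le> 2^k y^(2n), the \<open>k\<close>-th power of the divisor bound
    contributes y^(2 n \<delta> k), which is to equal y^\<epsilon>.\<close>
  define \<delta> where "\<delta> = \<epsilon> / (2 * real n * real k)"
  have \<delta>: "\<delta> > 0" using assms by (simp add: \<delta>_def)
  obtain C where C: "C \<ge> 1" "\<And>n::nat. n > 0 \<Longrightarrow> real (card {d. d dvd n}) \<le> C * real n powr \<delta>"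
    using divisor_bound[OF \<delta>] by blast
  define B where "B = 2 * (C * (2 ^ k) powr \<delta>)"
  have "real ((2 * card {d::nat. d dvd nat \<bar>H\<bar>}) ^ k) \<le> B ^ k * real y powr \<epsilon>"
    if y: "0 < y" and xy: "x \<le> y ^ 2" and H: "H \<noteq> 0" "\<bar>H\<bar> \<le> 2 ^ k * int x ^ n" for x y :: nat and H :: int
  proof -
    have "real (nat \<bar>H\<bar>) \<le> 2 ^ k * real x ^ n"
    proof -
      have "real_of_int \<bar>H\<bar> \<le> real_of_int (2 ^ k * int x ^ n)" using H(2) by (simp only: of_int_le_iff)
      then show ?thesis by simp
    qed
    also have "\<dots> \<le> 2 ^ k * (real y ^ 2) ^ n"
    proof -
      have "real x \<le> real (y ^ 2)" using xy by (simp only: of_nat_le_iff)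
      then show ?thesis by (intro mult_left_mono power_mono) auto
    qed
    also have "\<dots> = 2 ^ k * real y ^ (2 * n)" by (simp add: power_mult)
    finally have Hle: "real (nat \<bar>H\<bar>) \<le> 2 ^ k * real y ^ (2 * n)" .
    have "real (card {d::nat. d dvd nat \<bar>H\<bar>}) \<le> C * real (nat \<bar>H\<bar>) powr \<delta>"
      using H(1) by (intro C(2)) simp
    also have "\<dots> \<le> C * (2 ^ k * real y ^ (2 * n)) powr \<delta>"
      using C(1) Hle \<delta> by (intro mult_left_mono powr_mono2) auto
    also have "\<dots> = C * (2 ^ k) powr \<delta> * real y powr (2 * n * \<delta>)"
    proof -
      have "(real y ^ (2 * n)) powr \<delta> = real y powr (2 * n * \<delta>)"
        using y by (simp add: powr_powr flip: powr_realpow)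
      then show ?thesis by (simp add: powr_mult)
    qed
    finally have "2 * real (card {d::nat. d dvd nat \<bar>H\<bar>}) \<le> B * real y powr (2 * n * \<delta>)"
      by (simp add: B_def)
    then have "(2 * real (card {d::nat. d dvd nat \<bar>H\<bar>})) ^ k \<le> (B * real y powr (2 * n * \<delta>)) ^ k"
      by (intro power_mono) auto
    also have "\<dots> = B ^ k * real y powr (2 * n * \<delta> * k)"
      using y by (simp add: power_mult_distrib powr_power mult_ac)
    also have "2 * n * \<delta> * k = \<epsilon>" using assms by (simp add: \<delta>_def)
    finally show ?thesis by simp
  qed
  moreover have "B ^ k > 0" using C(1) by (simp add: B_def)
  ultimately show ?thesis by blast
qed

text \<open>Both terms of the recursion have the order claimed for \<open>Suc k\<close>. The loss
  y^\<epsilon> does not accumulate: the first term inherits it from the induction hypothesis, the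
  second takes it from the divisor bound, and the two are added.\<close>

lemma moment_bound:
  fixes n k :: nat and \<epsilon> :: real
  assumes "\<epsilon> > 0" "1 \<le> k" "k \<le> n"
  shows "\<exists>C>0. \<forall>x y. 0 < y \<longrightarrow> y \<le> x \<longrightarrow> x \<le> y ^ 2 \<longrightarrow>
           moment n k x y \<le> C * real y powr (2 ^ k - real k + \<epsilon>)"
  using assms(2,3)
proof (induction k rule: nat_induct_at_least)
  case base
  have "moment n 1 x y \<le> 1 * real y powr (2 ^ 1 - real 1 + \<epsilon>)" if "0 < y" "y \<le> x" for x y
  proof -
    have "moment n 1 x y \<le> real y" using that base by (intro moment_one_le) auto
    also have "real y = real y powr 1" using that by simp
    also have "\<dots> \<le> real y powr (2 ^ 1 - real 1 + \<epsilon>)"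
      using that \<open>\<epsilon> > 0\<close> by (intro powr_mono) auto
    finally show ?thesis by simp
  qed
  then show ?case using zero_less_one by blast
next
  case (Suc k)
  have "k \<le> n" using Suc.prems by simp
  from Suc.IH[OF this] obtain C where C: "C > 0"
    "\<And>x y. 0 < y \<Longrightarrow> y \<le> x \<Longrightarrow> x \<le> y ^ 2 \<Longrightarrow> moment n k x y \<le> C * real y powr (2 ^ k - real k + \<epsilon>)"
    by blast
  obtain D where D: "D > 0" "\<And>(x::nat) (y::nat) H. 0 < y \<Longrightarrow> x \<le> y ^ 2 \<Longrightarrow> H \<noteq> 0 \<Longrightarrow> \<bar>H\<bar> \<le> 2 ^ k * int x ^ n \<Longrightarrow>
           real ((2 * card {d::nat. d dvd nat \<bar>H\<bar>}) ^ k) \<le> D * real y powr \<epsilon>"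
    using divisor_count_power_bound[OF assms(1), of k n] Suc.hyps Suc.prems by auto
  define E where "E = 2 ^ k - k - (1::nat)"
  have E: "real E = 2 ^ k - real k - 1"
  proof -
    have "k + 1 \<le> 2 ^ k" using Suc_Suc_le_two_power_Suc[of "k - 1"] Suc.hyps by simp
    then have "real E = real (2 ^ k) - real k - 1" unfolding E_def by linarith
    then show ?thesis by simp
  qed
  \<comment> \<open>Collects the powers of 2 from \<open>(2 * Y) ^ E\<close> and
    \<open>(2 * Y) ^ (k - 1)\<close> along with the constants of both terms.\<close>
  define K where "K = 2 ^ E * (real k * 2 ^ (k - 1) * C + D)"
  have "moment n (Suc k) x y \<le> K * real y powr (2 ^ Suc k - real (Suc k) + \<epsilon>)"
    if xy: "0 < y" "y \<le> x" "x \<le> y ^ 2" for x y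
  proof -
    define Y where "Y = real y"
    have Y: "Y > 0" using xy by (simp add: Y_def)
    have p: "Y ^ i = Y powr real i" for i using Y by (simp add: powr_realpow)
    have "moment n (Suc k) x y \<le> (2 * Y) ^ E *
       (real k * (2 * Y) ^ (k - 1) * Y * moment n k x y + Y ^ (2 ^ k) * (D * Y powr \<epsilon>))"
      unfolding E_def Y_def using Suc.hyps Suc.prems xy D
      by (intro moment_Suc_le) auto
    also have "\<dots> \<le> (2 * Y) ^ E *
       (real k * (2 * Y) ^ (k - 1) * Y * (C * Y powr (2 ^ k - real k + \<epsilon>)) + Y ^ (2 ^ k) * (D * Y powr \<epsilon>))"
      using C(2)[OF xy] Y by (intro mult_left_mono add_right_mono) (auto simp: Y_def)
    also have "\<dots> = 2 ^ E * (real k * 2 ^ (k - 1) * C * (Y ^ E * (Y ^ (k - 1) * Y) * Y powr (2 ^ k - real k + \<epsilon>))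
         + D * (Y ^ E * Y ^ (2 ^ k) * Y powr \<epsilon>))"
      by (simp add: power_mult_distrib algebra_simps)
    also have "Y ^ (k - 1) * Y = Y ^ k" using Suc.hyps by (simp add: power_eq_if)
    also have "Y ^ E * Y ^ k * Y powr (2 ^ k - real k + \<epsilon>) = Y powr (2 ^ Suc k - real (Suc k) + \<epsilon>)"
      unfolding p powr_add[symmetric] E by (rule arg_cong[of _ _ "\<lambda>t. Y powr t"]) simp
    also have "Y ^ E * Y ^ (2 ^ k) * Y powr \<epsilon> = Y powr (2 ^ Suc k - real (Suc k) + \<epsilon>)"
      unfolding p powr_add[symmetric] E by (rule arg_cong[of _ _ "\<lambda>t. Y powr t"]) simp
    finally show ?thesis unfolding K_def Y_def by (simp add: algebra_simps)
  qed
  moreover have "K > 0" using C D by (simp add: K_def add_nonneg_pos)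
  ultimately show ?case by blast
qed

text \<open>For x \<ge> 3 the logarithm is at least 1. For \<open>x\<close> equal to 0 or 1 the
  upper bound evaluates to 0, with \<open>inverse 0 = 0\<close> when x = 1, and contradicts the
  lower one.\<close>

lemma le_of_le_div_ln:
  fixes x y :: nat
  assumes "sqrt (real x) < real y" "real y \<le> real x * inverse (ln (real x))"
  shows "y \<le> x"
proof -
  consider "x = 0" | "x = 1" | "x = 2" | "x \<ge> 3" by linarith
  then show ?thesis
  proof cases
    case 3
    \<comment> \<open>Here ln 2 < 1, so integrality of \<open>y\<close> is used: 2 / ln 2 < 3 forces
      y \<le> 2.\<close>
    have "2 / 3 < ln (2::real)"
      using ln_approx_bounds[of 2 2, simplified, simplified eval_nat_numeral, simplified] by simp
    then have "2 * inverse (ln 2) < (3::real)" by (simp add: field_simps)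
    then have "real y < 3" using assms(2) 3 by simp
    then show ?thesis using 3 by simp
  next
    case 4
    then have "1 \<le> ln (real x)" using exp_le by (subst ln_ge_iff) auto
    then have "real x * inverse (ln (real x)) \<le> real x * 1"
      by (intro mult_left_mono) (auto simp: inverse_le_1_iff)
    then show ?thesis using assms(2) by simp
  qed (use assms in auto)
qed

theorem theorem1p3:
  fixes n k :: nat and \<epsilon> :: real
  assumes "n \<ge> 2" and "\<epsilon> > 0" and "1 \<le> k" and "k \<le> n"
  shows "\<exists>C>0. \<forall>x y :: nat. sqrt (real x) < real y \<and> real y \<le> real x * inverse (ln (real x)) \<longrightarrow>
           integral {0..1} (\<lambda>\<alpha>::real. cmod (T n \<alpha> x y) ^ (2 ^ k))
             \<le> C * real y powr (2 ^ k - real k + \<epsilon>)"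
proof -
  obtain C where C: "C > 0" "\<And>x y. 0 < y \<Longrightarrow> y \<le> x \<Longrightarrow> x \<le> y ^ 2 \<Longrightarrow>
      moment n k x y \<le> C * real y powr (2 ^ k - real k + \<epsilon>)"
    using moment_bound[OF assms(2-4)] by blast
  have "moment n k x y \<le> C * real y powr (2 ^ k - real k + \<epsilon>)"
    if xy: "sqrt (real x) < real y" "real y \<le> real x * inverse (ln (real x))" for x y
  proof (rule C(2))
    have "0 \<le> sqrt (real x)" by simp
    then show "0 < y" using xy(1) by linarith
    show "y \<le> x" using xy by (rule le_of_le_div_ln)
    have "real x \<le> real y ^ 2" by (rule sqrt_le_D) (use xy(1) in simp)
    then show "x \<le> y ^ 2" by (metis of_nat_le_iff of_nat_power)
  qed
  then show ?thesis using C(1) unfolding moment_def by blast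
qed

end
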